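(* Let $t\ge 2$ be an integer. The generating function $P_{R,F}^{(t,t)}(q)=\sum_{n\ge0} a(n)q^n$, where $a(n)$ is the number of partitions of $n$ that are both $t$-regular and $t$-flat, is $$P_{R,F}^{(t,t)}(q)=\sum_{j=0}^\infty \sum_{i=0}^j\frac{(-1)^i q^{\binom{i+1}{2}t+j-i}\,(q^{(i+1)t};q^t)_{j-i}}{(q;q)_{j-i}}.$$
   Context: A partition $\lambda_1\ge\lambda_2\ge\dots\ge\lambda_k$ is $t$-regular if no part is divisible by $t$, and $t$-flat if $\lambda_i-\lambda_{i+1}<t$ for all $1\le i<k$ and the smallest part $\lambda_k$ is less than $t$ (the empty partition is counted as a partition of $0$ with both properties). Notation: $(a;q)_n=\prod_{i=0}^{n-1}(1-aq^i)$, with $(a;q)_0=1$. *)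

theory Defs
  imports "HOL-Computational_Algebra.Formal_Power_Series"
begin

definition is_partition :: "nat list \<Rightarrow> bool" where
  "is_partition ps \<longleftrightarrow> sorted_wrt (\<ge>) ps \<and> (\<forall>p \<in> set ps. 0 < p)"

definition t_regular :: "nat \<Rightarrow> nat list \<Rightarrow> bool" where
  "t_regular t ps \<longleftrightarrow> (\<forall>p \<in> set ps. \<not> t dvd p)"

text \<open>
  Only applied to partitions, where the parts decrease weakly: the truncated difference of
  consecutive parts is then the true difference, and the last entry is the smallest part.
\<close>
definition t_flat :: "nat \<Rightarrow> nat list \<Rightarrow> bool" where
  "t_flat t ps \<longleftrightarrow>
     (\<forall>i. Suc i < length ps \<longrightarrow> ps ! i - ps ! Suc i < t) \<and>
     (ps \<noteq> [] \<longrightarrow> last ps < t)"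

definition regular_flat_partitions :: "nat \<Rightarrow> nat \<Rightarrow> nat list set" where
  "regular_flat_partitions t n =
     {ps. is_partition ps \<and> sum_list ps = n \<and> t_regular t ps \<and> t_flat t ps}"

lemma finite_regular_flat_partitions: "finite (regular_flat_partitions t n)"
proof (rule finite_subset)
  have "length xs \<le> sum_list xs" if "\<forall>p \<in> set xs. 0 < p" for xs :: "nat list"
    using that by (induction xs) auto
  then show "regular_flat_partitions t n \<subseteq> {xs. set xs \<subseteq> {..n} \<and> length xs \<le> n}"
    by (auto simp: regular_flat_partitions_def is_partition_def intro: member_le_sum_list)
  show "finite {xs. set xs \<subseteq> {..n} \<and> length xs \<le> n}"
    by (rule finite_lists_length_le) simp
qed

definition regular_flat_gf :: "nat \<Rightarrow> rat fps" where
  "regular_flat_gf t = Abs_fps (\<lambda>n. of_nat (card (regular_flat_partitions t n)))"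

definition qpochhammer :: "'a::comm_ring_1 \<Rightarrow> 'a \<Rightarrow> nat \<Rightarrow> 'a" where
  "qpochhammer a q n = (\<Prod>i<n. 1 - a * q ^ i)"

end

theory Submission
  imports Defs
begin

text \<open>
  The \<open>j\<close>-th summand enumerates the partitions with exactly \<open>j\<close> parts. Write \<open>Q = q\<^sup>t\<close>.
  Adding \<open>t\<close> to the \<open>k\<close> largest parts maps the \<open>t\<close>-regular partitions with \<open>j\<close> parts onto those whose
  \<open>k\<close>-th gap is at least \<open>t\<close>, so forbidding such a gap multiplies the generating function by
  \<open>1 - Q\<^sup>k\<close>; forbidding all of them gives the factor \<open>(Q;Q)\<^sub>j\<close>. The same argument with \<open>t = 1\<close>
  shows that all partitions with \<open>m\<close> parts are enumerated by \<open>q\<^sup>m / (q;q)\<^sub>m\<close>. Finally, the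
  multiples \<open>t, 2t, \<dots>, st\<close> are excluded one at a time, which introduces the elementary symmetric
  polynomials in \<open>Q, \<dots>, Q\<^sup>s\<close>; as \<open>s\<close> grows, the one of degree \<open>i\<close> tends to
  \<open>Q\<^bsup>i(i+1)/2\<^esup> / (Q;Q)\<^sub>i\<close>.
\<close>

subsection \<open>Weight enumerators of sets of lists\<close>

text \<open>Applied to sets of lists of one fixed length. Only finitely many such lists have a given
  sum, so each \<open>card\<close> is a true count and not the default 0 of an infinite set.\<close>

definition list_gf :: "nat list set \<Rightarrow> rat fps" where
  "list_gf A = Abs_fps (\<lambda>n. of_nat (card {ps \<in> A. sum_list ps = n}))"

definition decreasing_lists :: "nat set \<Rightarrow> nat \<Rightarrow> nat list set" where
  "decreasing_lists V j = {ps. length ps = j \<and> sorted_wrt (\<ge>) ps \<and> set ps \<subseteq> V}"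

lemma decreasing_lists_iff_nth:
  "ps \<in> decreasing_lists V j \<longleftrightarrow>
     length ps = j \<and> (\<forall>i<j. ps ! i \<in> V) \<and> (\<forall>i k. i < k \<longrightarrow> k < j \<longrightarrow> ps ! k \<le> ps ! i)"
  by (auto simp: decreasing_lists_def sorted_wrt_iff_nth_less subset_iff in_set_conv_nth)

lemma finite_lists_of_length_and_sum:
  assumes "A \<subseteq> {ps. length ps = j}"
  shows "finite {ps \<in> A. sum_list ps = (n::nat)}"
proof (rule finite_subset)
  show "{ps \<in> A. sum_list ps = n} \<subseteq> {ps. set ps \<subseteq> {..n} \<and> length ps = j}"
    using assms by (auto intro: member_le_sum_list)
  show "finite {ps. set ps \<subseteq> {..n} \<and> length ps = j}"
    by (rule finite_lists_length_eq) simp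
qed

lemma list_gf_Un_disjoint:
  assumes "A \<union> B \<subseteq> {ps. length ps = j}" "A \<inter> B = {}"
  shows "list_gf (A \<union> B) = list_gf A + list_gf B"
proof (rule fps_ext)
  fix n
  have "{ps \<in> A \<union> B. sum_list ps = n} = {ps \<in> A. sum_list ps = n} \<union> {ps \<in> B. sum_list ps = n}"
    by blast
  moreover have "card \<dots> = card {ps \<in> A. sum_list ps = n} + card {ps \<in> B. sum_list ps = n}"
    using assms by (intro card_Un_disjoint finite_lists_of_length_and_sum[of _ j]) auto
  ultimately show "fps_nth (list_gf (A \<union> B)) n = fps_nth (list_gf A + list_gf B) n"
    by (simp add: list_gf_def)
qed

lemma list_gf_bij_betw_shift:
  assumes f: "bij_betw f A B" and w: "\<And>ps. ps \<in> A \<Longrightarrow> sum_list (f ps) = sum_list ps + k"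
  shows "list_gf B = fps_X ^ k * list_gf A"
proof (rule fps_ext)
  fix n
  show "fps_nth (list_gf B) n = fps_nth (fps_X ^ k * list_gf A) n"
  proof (cases "n < k")
    case True
    have "{ps \<in> B. sum_list ps = n} = {}"
      using f w True by (force simp: bij_betw_def)
    then have "card {ps \<in> B. sum_list ps = n} = 0"
      by (simp only: card.empty)
    then show ?thesis
      using True by (simp add: list_gf_def fps_X_power_mult_nth del: card_eq_0_iff)
  next
    case False
    have "bij_betw f {ps \<in> A. sum_list ps = n - k} {ps \<in> B. sum_list ps = n}"
      using f w False by (auto simp: bij_betw_def inj_on_def)
    from bij_betw_same_card[OF this] show ?thesis
      using False by (simp add: list_gf_def fps_X_power_mult_nth)
  qed
qed

subsection \<open>Enforcing small gaps\<close>

text \<open>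
  The last part is allowed to be equal to \<open>t\<close>. For \<open>t\<close>-regular partitions this is the same as
  being less than \<open>t\<close>, and for \<open>t = 1\<close> it leaves exactly the partitions into ones.
\<close>
definition short_gap :: "nat \<Rightarrow> nat list \<Rightarrow> nat \<Rightarrow> bool" where
  "short_gap t ps k \<longleftrightarrow>
     (if Suc k < length ps then ps ! k - ps ! Suc k < t else ps ! k \<le> t)"

text \<open>The argument \<open>m\<close> says how many gap conditions, counted from the largest
  part, are already in force. It is the induction variable when the gaps are closed one at a
  time.\<close>

definition short_gap_lists :: "nat \<Rightarrow> nat set \<Rightarrow> nat \<Rightarrow> nat \<Rightarrow> nat list set" where
  "short_gap_lists t V j m = {ps \<in> decreasing_lists V j. \<forall>k<m. short_gap t ps k}"

lemma short_gap_lists_length: "short_gap_lists t V j m \<subseteq> {ps. length ps = j}"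
  by (auto simp: short_gap_lists_def decreasing_lists_def)

text \<open>On a decreasing list the first \<open>m\<close> entries are the largest ones. For
  conjugate partitions this inserts \<open>t\<close> parts equal to \<open>m\<close>.\<close>

definition raise :: "nat \<Rightarrow> nat \<Rightarrow> nat list \<Rightarrow> nat list" where
  "raise t m ps = map (\<lambda>v. v + t) (take m ps) @ drop m ps"

lemma length_raise [simp]: "length (raise t m ps) = length ps"
  by (simp add: raise_def)

lemma nth_raise:
  "i < length ps \<Longrightarrow> raise t m ps ! i = (if i < m then ps ! i + t else ps ! i)"
  by (auto simp: raise_def nth_append)

lemma sum_list_raise:
  assumes "m \<le> length ps"
  shows "sum_list (raise t m ps) = sum_list ps + t * m"
proof -
  have "sum_list ps = sum_list (take m ps) + sum_list (drop m ps)"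
    by (metis append_take_drop_id sum_list_append)
  then show ?thesis
    using assms by (simp add: raise_def sum_list_addf sum_list_triv)
qed

text \<open>Raising the first \<open>m + 1\<close> entries keeps all earlier gaps and widens gap
  \<open>m\<close> by \<open>t\<close>, so exactly that gap becomes too long; subtracting
  \<open>t\<close> undoes this. Invariance of \<open>V\<close> under shifts by \<open>t\<close>
  keeps the entries admissible in both directions.\<close>

lemma bij_betw_raise:
  assumes V: "0 \<notin> V" "\<And>v. 0 < v \<Longrightarrow> v + t \<in> V \<longleftrightarrow> v \<in> V" and m: "m < j"
  shows "bij_betw (raise t (Suc m)) (short_gap_lists t V j m)
           (short_gap_lists t V j m - short_gap_lists t V j (Suc m))"
proof (rule bij_betw_byWitness
    [where f' = "\<lambda>ps. map (\<lambda>v. v - t) (take (Suc m) ps) @ drop (Suc m) ps"])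
  let ?lower = "\<lambda>ps. map (\<lambda>v. v - t) (take (Suc m) ps) @ drop (Suc m) ps"
  have pos: "0 < ps ! i" if "ps \<in> decreasing_lists V j" "i < j" for ps i
    using that V(1) by (metis decreasing_lists_iff_nth gr0I)
  have lower_nth: "?lower ps ! i = (if i < Suc m then ps ! i - t else ps ! i)"
    if "i < length ps" for ps i
    using that by (auto simp: nth_append)
  show "\<forall>ps \<in> short_gap_lists t V j m. ?lower (raise t (Suc m) ps) = ps"
  proof
    fix ps assume "ps \<in> short_gap_lists t V j m"
    show "?lower (raise t (Suc m) ps) = ps"
      by (rule nth_equalityI) (auto simp: lower_nth nth_raise)
  qed
  \<comment> \<open>A violated condition at \<open>m\<close> is what makes lowering possible: the
    lowered entries stay positive and do not fall below entry \<open>m + 1\<close>.\<close>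
  have large: "ps ! i > t \<and> (i < Suc m \<longrightarrow> Suc m < j \<longrightarrow> ps ! Suc m + t \<le> ps ! i)"
    if ps: "ps \<in> short_gap_lists t V j m - short_gap_lists t V j (Suc m)" and i: "i < Suc m" for ps i
  proof -
    have L: "ps \<in> decreasing_lists V j" and gap: "\<not> short_gap t ps m"
      using ps by (auto simp: short_gap_lists_def less_Suc_eq)
    have len: "length ps = j" and mono: "ps ! m \<le> ps ! i"
      using L i m by (auto simp: decreasing_lists_iff_nth less_Suc_eq)
    show ?thesis
    proof (cases "Suc m < j")
      case True
      then have "ps ! Suc m + t \<le> ps ! m"
        using gap L len by (simp add: short_gap_def decreasing_lists_iff_nth)
          (metis le_add_diff_inverse lessI nat_add_left_cancel_le not_less)
      moreover have "0 < ps ! Suc m"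
        using pos[OF L True] .
      ultimately show ?thesis
        using mono by linarith
    next
      case False
      then show ?thesis
        using gap len mono by (auto simp: short_gap_def)
    qed
  qed
  show "\<forall>ps \<in> short_gap_lists t V j m - short_gap_lists t V j (Suc m).
          raise t (Suc m) (?lower ps) = ps"
  proof
    fix ps assume ps: "ps \<in> short_gap_lists t V j m - short_gap_lists t V j (Suc m)"
    have "raise t (Suc m) (?lower ps) ! i = ps ! i" if "i < length ps" for i
    proof -
      have "i < length (?lower ps)"
        using that by simp
      from nth_raise[OF this] show ?thesis
        using large[OF ps, of i] that by (simp only: lower_nth) auto
    qed
    then show "raise t (Suc m) (?lower ps) = ps"
      by (intro nth_equalityI) auto
  qed
  show "raise t (Suc m) ` short_gap_lists t V j m
          \<subseteq> short_gap_lists t V j m - short_gap_lists t V j (Suc m)"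
  proof
    fix qs assume "qs \<in> raise t (Suc m) ` short_gap_lists t V j m"
    then obtain ps where qs: "qs = raise t (Suc m) ps" and ps: "ps \<in> short_gap_lists t V j m"
      by blast
    have L: "ps \<in> decreasing_lists V j" and gap: "\<And>k. k < m \<Longrightarrow> short_gap t ps k"
      using ps by (auto simp: short_gap_lists_def)
    have len: "length ps = j" and mono: "\<And>i k. i < k \<Longrightarrow> k < j \<Longrightarrow> ps ! k \<le> ps ! i"
      and memV: "\<And>i. i < j \<Longrightarrow> ps ! i \<in> V"
      using L by (auto simp: decreasing_lists_iff_nth)
    have nth: "qs ! i = (if i < Suc m then ps ! i + t else ps ! i)" if "i < j" for i
      using that len by (simp add: qs nth_raise)
    have lenq: "length qs = j"
      using len by (simp add: qs)
    have "qs \<in> decreasing_lists V j"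
      unfolding decreasing_lists_iff_nth
      using lenq mono memV pos[OF L] V(2) by (auto simp: nth trans_le_add1)
    moreover have "short_gap t qs k" if "k < m" for k
      using gap[OF that] that m len lenq by (simp add: short_gap_def nth)
    moreover have "\<not> short_gap t qs m"
      using mono[of m "Suc m"] pos[OF L m] m lenq by (auto simp: short_gap_def nth)
    ultimately show "qs \<in> short_gap_lists t V j m - short_gap_lists t V j (Suc m)"
      by (auto simp: short_gap_lists_def)
  qed
  show "?lower ` (short_gap_lists t V j m - short_gap_lists t V j (Suc m))
          \<subseteq> short_gap_lists t V j m"
  proof
    fix qs assume "qs \<in> ?lower ` (short_gap_lists t V j m - short_gap_lists t V j (Suc m))"
    then obtain ps where qs: "qs = ?lower ps"
      and ps: "ps \<in> short_gap_lists t V j m - short_gap_lists t V j (Suc m)"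
      by blast
    have L: "ps \<in> decreasing_lists V j" and gap: "\<And>k. k < m \<Longrightarrow> short_gap t ps k"
      using ps by (auto simp: short_gap_lists_def)
    have len: "length ps = j" and mono: "\<And>i k. i < k \<Longrightarrow> k < j \<Longrightarrow> ps ! k \<le> ps ! i"
      and memV: "\<And>i. i < j \<Longrightarrow> ps ! i \<in> V"
      using L by (auto simp: decreasing_lists_iff_nth)
    have lenq: "length qs = j"
      using len by (simp add: qs)
    have nth: "qs ! i = (if i < Suc m then ps ! i - t else ps ! i)" if "i < j" for i
      using that len unfolding qs by (subst lower_nth) auto
    have "qs ! i \<in> V" if "i < j" for i
    proof (cases "i < Suc m")
      case True
      have "ps ! i - t + t \<in> V" "0 < ps ! i - t"
        using large[OF ps True] memV[OF that] by auto
      then show ?thesis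
        using V(2)[of "ps ! i - t"] True by (simp only: nth[OF that] if_True)
    qed (simp add: nth that memV)
    \<comment> \<open>Only a lowered entry followed by an unlowered one could lose its order, and
      the long gap at \<open>m\<close> absorbs that loss.\<close>
    moreover have "qs ! k \<le> qs ! i" if "i < k" "k < j" for i k
    proof (cases "i < Suc m \<and> \<not> k < Suc m")
      case True
      then have "ps ! k \<le> ps ! Suc m"
        using mono[of "Suc m" k] that by (cases "k = Suc m") auto
      moreover have "ps ! Suc m + t \<le> ps ! i"
        using large[OF ps, of i] True that by auto
      ultimately show ?thesis
        using True that by (simp add: nth)
    qed (use that mono[of i k] in \<open>auto simp: nth\<close>)
    ultimately have "qs \<in> decreasing_lists V j"
      using lenq by (auto simp: decreasing_lists_iff_nth)
    moreover have "short_gap t qs k" if "k < m" for k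
      using gap[OF that] that m len lenq large[OF ps, of k] large[OF ps, of "Suc k"]
      by (auto simp: short_gap_def nth)
    ultimately show "qs \<in> short_gap_lists t V j m"
      by (auto simp: short_gap_lists_def)
  qed
qed

text \<open>The lists lost when condition \<open>m\<close> is imposed are the images under
  \<open>raise\<close>, which adds \<open>t * (m + 1)\<close> to the sum. Each condition therefore
  contributes a factor \<open>1 - fps_X ^ (t * (m + 1))\<close>.\<close>

lemma list_gf_short_gap_lists:
  assumes V: "0 \<notin> V" "\<And>v. 0 < v \<Longrightarrow> v + t \<in> V \<longleftrightarrow> v \<in> V" and "m \<le> j"
  shows "list_gf (short_gap_lists t V j m) =
           qpochhammer (fps_X ^ t) (fps_X ^ t) m * list_gf (decreasing_lists V j)"
  using \<open>m \<le> j\<close>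
proof (induction m)
  case 0
  then show ?case
    by (simp add: short_gap_lists_def qpochhammer_def)
next
  case (Suc m)
  let ?S = "short_gap_lists t V j"
  have "?S (Suc m) \<union> (?S m - ?S (Suc m)) = ?S m"
    by (auto simp: short_gap_lists_def)
  then have "list_gf (?S m) = list_gf (?S (Suc m)) + list_gf (?S m - ?S (Suc m))"
    using list_gf_Un_disjoint[of "?S (Suc m)" "?S m - ?S (Suc m)" j] short_gap_lists_length[of t V j m]
    by auto
  also have "list_gf (?S m - ?S (Suc m)) = fps_X ^ (t * Suc m) * list_gf (?S m)"
    using Suc.prems
    by (intro list_gf_bij_betw_shift[OF bij_betw_raise[OF V]] sum_list_raise)
       (auto simp: short_gap_lists_def decreasing_lists_def)
  finally have "list_gf (?S (Suc m)) = (1 - fps_X ^ (t * Suc m)) * list_gf (?S m)"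
    by (simp add: algebra_simps)
  then show ?case
    using Suc by (simp add: qpochhammer_def power_mult[symmetric] power_add mult_ac)
qed

text \<open>For \<open>t = 1\<close> the short gap conditions force all parts to be 1, which leaves
  a single list with sum \<open>j\<close>. The product form also shows that
  \<open>qpochhammer fps_X fps_X j\<close> is nonzero.\<close>

lemma list_gf_positive_parts:
  "qpochhammer fps_X fps_X j * list_gf (decreasing_lists {0<..} j) = fps_X ^ j"
proof -
  have one: "short_gap_lists 1 {0<..} j j = {replicate j 1}"
  proof (intro equalityI subsetI)
    fix ps assume ps: "ps \<in> short_gap_lists 1 {0<..} j j"
    then have len: "length ps = j" and pos: "\<And>i. i < j \<Longrightarrow> 0 < ps ! i"
      and gap: "\<And>k. k < j \<Longrightarrow> short_gap 1 ps k"
      by (auto simp: short_gap_lists_def decreasing_lists_iff_nth)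
    \<comment> \<open>The bound is known for the last entry and spreads towards the front, so the
      induction counts positions from the end.\<close>
    have upper: "ps ! (j - Suc d) \<le> 1" if "d < j" for d
      using that
    proof (induction d)
      case 0
      then show ?case
        using gap[of "j - 1"] len by (simp add: short_gap_def)
    next
      case (Suc d)
      then have "Suc (j - Suc (Suc d)) = j - Suc d"
        by simp
      then show ?case
        using Suc gap[of "j - Suc (Suc d)"] len by (auto simp: short_gap_def)
    qed
    have "ps ! i \<le> 1" if "i < j" for i
      using upper[of "j - Suc i"] that by (simp add: Suc_diff_Suc)
    then have "ps ! i = 1" if "i < j" for i
      using that pos by (metis le_antisym One_nat_def Suc_leI)
    then show "ps \<in> {replicate j 1}"
      using len by (auto intro: nth_equalityI)
  qed (auto simp: short_gap_lists_def decreasing_lists_iff_nth short_gap_def)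
  have "list_gf {replicate j 1} = fps_X ^ j"
  proof (rule fps_ext)
    fix n
    have "{ps \<in> {replicate j 1}. sum_list ps = n} = (if n = j then {replicate j 1} else {})"
      by (auto simp: sum_list_replicate)
    then show "fps_nth (list_gf {replicate j 1}) n = fps_nth (fps_X ^ j) n"
      by (simp add: list_gf_def fps_X_power_nth)
  qed
  then show ?thesis
    using list_gf_short_gap_lists[of "{0<..}" 1 j j] one by simp
qed

subsection \<open>Removing the multiples of \<open>t\<close>\<close>

text \<open>Either \<open>c\<close> does not occur, or deleting one copy of it leaves an arbitrary
  list that is shorter by one.\<close>

lemma list_gf_insert_part:
  assumes c: "c \<in> V"
  shows "list_gf (decreasing_lists V (Suc j)) =
           list_gf (decreasing_lists (V - {c}) (Suc j)) + fps_X ^ c * list_gf (decreasing_lists V j)"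
proof -
  \<comment> \<open>\<open>insort\<close> expects ascending lists, hence the two reversals.\<close>
  let ?f = "\<lambda>ps. rev (insort c (rev ps))"
  let ?B = "{ps \<in> decreasing_lists V (Suc j). c \<in> set ps}"
  have sorted: "sorted_wrt (\<ge>) ps \<longleftrightarrow> sorted (rev ps)" for ps :: "nat list"
    by (simp add: sorted_wrt_rev)
  have "bij_betw ?f (decreasing_lists V j) ?B"
  proof (rule bij_betw_byWitness[where f' = "\<lambda>ps. rev (remove1 c (rev ps))"])
    show "\<forall>ps \<in> decreasing_lists V j. rev (remove1 c (rev (?f ps))) = ps"
      by simp
    show "\<forall>ps \<in> ?B. ?f (rev (remove1 c (rev ps))) = ps"
      by (auto simp: decreasing_lists_def sorted insort_remove1)
    show "?f ` decreasing_lists V j \<subseteq> ?B"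
      using c by (auto simp: decreasing_lists_def sorted sorted_insort set_insort_key)
    show "(\<lambda>ps. rev (remove1 c (rev ps))) ` ?B \<subseteq> decreasing_lists V j"
      using set_remove1_subset[of c]
      by (fastforce simp: decreasing_lists_def sorted sorted_remove1 length_remove1)
  qed
  moreover have "sum_list (?f ps) = sum_list ps + c" for ps
  proof -
    have "sum_list (insort c xs) = sum_list xs + c" for xs
      by (induction xs) auto
    then show ?thesis
      by (simp only: sum_list_rev)
  qed
  ultimately have "list_gf ?B = fps_X ^ c * list_gf (decreasing_lists V j)"
    by (rule list_gf_bij_betw_shift)
  moreover have "decreasing_lists V (Suc j) = decreasing_lists (V - {c}) (Suc j) \<union> ?B"
    by (auto simp: decreasing_lists_def)
  moreover have "list_gf (decreasing_lists (V - {c}) (Suc j) \<union> ?B) =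
      list_gf (decreasing_lists (V - {c}) (Suc j)) + list_gf ?B"
    by (rule list_gf_Un_disjoint[of _ _ "Suc j"]) (auto simp: decreasing_lists_def)
  ultimately show ?thesis
    by simp
qed

text \<open>The elementary symmetric polynomial of degree \<open>i\<close> in \<open>x, x\<^sup>2, \<dots>, x\<^sup>s\<close>.\<close>
fun esym_powers :: "'a::comm_ring_1 \<Rightarrow> nat \<Rightarrow> nat \<Rightarrow> 'a" where
  "esym_powers x s 0 = 1"
| "esym_powers x 0 (Suc i) = 0"
| "esym_powers x (Suc s) (Suc i) = esym_powers x s (Suc i) + x ^ Suc s * esym_powers x s i"

lemma qpochhammer_0 [simp]: "qpochhammer a q 0 = 1"
  by (simp add: qpochhammer_def)

lemma qpochhammer_Suc [simp]: "qpochhammer a q (Suc n) = qpochhammer a q n * (1 - a * q ^ n)"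
  by (simp add: qpochhammer_def)

lemma qpochhammer_add:
  "qpochhammer a q (m + n) = qpochhammer a q m * qpochhammer (a * q ^ m) q n"
  by (induction n) (simp_all add: power_add mult.assoc)

text \<open>This is the q-binomial theorem cleared of denominators, so that it holds in every
  commutative ring. It follows from the recursion in \<open>s\<close>.\<close>

lemma esym_powers_closed_form:
  "qpochhammer x x i * esym_powers x s i = x ^ (Suc i choose 2) * (\<Prod>k<i. 1 - x ^ (s - k))"
proof (induction x s i rule: esym_powers.induct)
  case (1 x s)
  then show ?case
    by (simp add: numeral_2_eq_2)
next
  case (2 x i)
  have "(\<Prod>k<Suc i. 1 - x ^ (0 - k)) = 0"
    by (rule prod_zero) auto
  then show ?case
    by simp
next
  case (3 x s i)
  define P where "P = x ^ (Suc i choose 2) * (\<Prod>k<i. 1 - x ^ (s - k))"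
  have choose: "Suc (Suc i) choose 2 = (Suc i choose 2) + Suc i"
    by (simp add: numeral_2_eq_2)
  \<comment> \<open>For \<open>i > s\<close> the product contains the factor
    \<open>1 - x ^ 0\<close> at \<open>k = s\<close>, so the truncated exponent \<open>s - i\<close>
    does no harm.\<close>
  have P0: "P = 0" if "\<not> i \<le> s"
  proof -
    have "(\<Prod>k<i. 1 - x ^ (s - k)) = 0"
      using that by (intro prod_zero) (auto intro!: bexI[of _ s])
    then show ?thesis
      by (simp add: P_def)
  qed
  have "qpochhammer x x (Suc i) * esym_powers x (Suc s) (Suc i) =
      qpochhammer x x (Suc i) * esym_powers x s (Suc i)
        + x ^ Suc s * (1 - x ^ Suc i) * (qpochhammer x x i * esym_powers x s i)"
    by (simp add: algebra_simps)
  also have "\<dots> = P * (x ^ Suc i * (1 - x ^ (s - i)) + x ^ Suc s * (1 - x ^ Suc i))"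
    unfolding 3 choose by (simp add: P_def power_add algebra_simps)
  also have "\<dots> = P * (x ^ Suc i * (1 - x ^ Suc s))"
  proof (cases "i \<le> s")
    case True
    then have "x ^ Suc i * x ^ (s - i) = x ^ Suc s"
      unfolding power_add[symmetric] by simp
    then show ?thesis
      by (simp only: right_diff_distrib) (simp add: algebra_simps)
  qed (simp add: P0)
  also have "\<dots> = x ^ (Suc (Suc i) choose 2) * (\<Prod>k<Suc i. 1 - x ^ (Suc s - k))"
    unfolding choose prod.lessThan_Suc_shift by (simp add: P_def power_add mult_ac)
  finally show ?case .
qed

text \<open>Forbidding the part \<open>t * (s + 1)\<close> subtracts
  \<open>(fps_X ^ t) ^ (s + 1)\<close> times the enumerator for one part fewer. With the alternating
  signs this is the recursion of \<open>esym_powers\<close>.\<close>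

lemma list_gf_avoiding_multiples:
  assumes "0 < t"
  shows "list_gf (decreasing_lists ({0<..} - (\<lambda>k. t * k) ` {1..s}) j) =
    (\<Sum>i\<le>j. (-1) ^ i * esym_powers (fps_X ^ t) s i * list_gf (decreasing_lists {0<..} (j - i)))"
proof (induction s arbitrary: j)
  case 0
  have "(\<Sum>i\<le>j. (-1) ^ i * esym_powers (fps_X ^ t) 0 i * list_gf (decreasing_lists {0<..} (j - i))) =
      (\<Sum>i\<in>{0}. (-1) ^ i * esym_powers (fps_X ^ t) 0 i * list_gf (decreasing_lists {0<..} (j - i)))"
  proof (rule sum.mono_neutral_right)
    show "\<forall>i \<in> {..j} - {0}. (-1) ^ i * esym_powers (fps_X ^ t) 0 i
            * list_gf (decreasing_lists {0<..} (j - i)) = 0"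
    proof
      fix i assume "i \<in> {..j} - {0}"
      then show "(-1) ^ i * esym_powers (fps_X ^ t) 0 i
            * list_gf (decreasing_lists {0<..} (j - i)) = 0"
        by (cases i) auto
    qed
  qed auto
  then show ?case
    by simp
next
  case (Suc s)
  let ?V = "\<lambda>s. {0<..} - (\<lambda>k. t * k) ` {1..s}"
  show ?case
  proof (cases j)
    case 0
    have "decreasing_lists V 0 = {[]}" for V
      by (auto simp: decreasing_lists_def)
    then show ?thesis
      using 0 by simp
  next
    case j: (Suc j')
    have "t * Suc s \<in> ?V s"
      using assms by (auto simp del: mult_Suc_right)
    moreover have "?V s - {t * Suc s} = ?V (Suc s)"
      by (simp add: atLeastAtMostSuc_conv) blast
    ultimately have "list_gf (decreasing_lists (?V (Suc s)) j) =
        list_gf (decreasing_lists (?V s) (Suc j'))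
          - (fps_X ^ t) ^ Suc s * list_gf (decreasing_lists (?V s) j')"
      using list_gf_insert_part[of "t * Suc s" "?V s" j'] unfolding j power_mult
      by simp
    also have "\<dots> = (\<Sum>i\<le>j. (-1) ^ i * esym_powers (fps_X ^ t) (Suc s) i
                        * list_gf (decreasing_lists {0<..} (j - i)))"
      unfolding Suc j sum.atMost_Suc_shift
      by (simp add: sum_distrib_left sum_negf sum.distrib sum_subtractf algebra_simps)
    finally show ?thesis .
  qed
qed

subsection \<open>Passing to the limit\<close>

text \<open>Agreement of the coefficients below \<open>n\<close> becomes a congruence modulo
  \<open>fps_X ^ n\<close>, so the limit in \<open>s\<close> can be taken by ring
  arithmetic.\<close>

lemma fps_X_power_dvd_iff:
  "fps_X ^ n dvd (f :: 'a::field fps) \<longleftrightarrow> (\<forall>k<n. fps_nth f k = 0)"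
proof
  assume "\<forall>k<n. fps_nth f k = 0"
  then have "f = fps_X ^ n * fps_shift n f"
    by (intro fps_ext) (simp add: fps_X_power_mult_nth)
  then show "fps_X ^ n dvd f"
    by (rule dvdI)
qed (auto simp: fps_X_power_mult_nth)

lemma fps_eq_if_cong_fps_X_power:
  fixes f g :: "'a::field fps"
  assumes "\<And>n. fps_X ^ n dvd f - g"
  shows "f = g"
proof (rule fps_ext)
  fix n
  show "fps_nth f n = fps_nth g n"
    using assms[of "Suc n"] unfolding fps_X_power_dvd_iff by simp
qed

text \<open>In the closed form every factor \<open>1 - (fps_X ^ t) ^ (s - k)\<close> with
  \<open>k < i\<close> is 1 modulo \<open>fps_X ^ n\<close>, because
  \<open>s - k \<ge> n\<close>.\<close>

lemma esym_powers_cong: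
  fixes t :: nat
  assumes "0 < t" "n + i \<le> s"
  shows "fps_X ^ n dvd qpochhammer (fps_X ^ t) (fps_X ^ t) i * esym_powers (fps_X ^ t) s i
           - (fps_X ^ t :: 'a::field fps) ^ (Suc i choose 2)"
proof -
  let ?Q = "fps_X ^ t :: 'a fps"
  have "fps_X ^ n dvd (\<Prod>k<m. 1 - ?Q ^ (s - k)) - 1" if "m \<le> i" for m
    using that
  proof (induction m)
    case (Suc m)
    have "n \<le> 1 * (s - m)"
      using Suc.prems assms(2) by simp
    also have "\<dots> \<le> t * (s - m)"
      using assms(1) by (intro mult_right_mono) auto
    finally have "fps_X ^ n dvd ?Q ^ (s - m)"
      by (simp add: le_imp_power_dvd flip: power_mult)
    moreover have "(\<Prod>k<Suc m. 1 - ?Q ^ (s - k)) - 1 =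
        ((\<Prod>k<m. 1 - ?Q ^ (s - k)) - 1) - ?Q ^ (s - m) * (\<Prod>k<m. 1 - ?Q ^ (s - k))"
      by (simp add: algebra_simps)
    ultimately show ?case
      using dvd_diff[OF Suc.IH dvd_mult2] Suc.prems by (metis Suc_leD)
  qed simp
  from dvd_mult[OF this[OF order_refl], of "?Q ^ (Suc i choose 2)"] show ?thesis
    by (simp add: esym_powers_closed_form right_diff_distrib)
qed

text \<open>A positive multiple \<open>t * c\<close> that is a part of a list with sum below
  \<open>n\<close> has \<open>c < n\<close>, so it is already among the excluded values.\<close>

lemma list_gf_regular_cong:
  "fps_X ^ n dvd list_gf (decreasing_lists {v. \<not> t dvd v} j)
     - list_gf (decreasing_lists ({0<..} - (\<lambda>k. t * k) ` {1..n}) j)"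
  unfolding fps_X_power_dvd_iff
proof (intro allI impI)
  fix k assume k: "k < n"
  have "v \<in> {v. \<not> t dvd v} \<longleftrightarrow> v \<in> {0<..} - (\<lambda>k. t * k) ` {1..n}" if "v \<le> k" for v
  proof (cases "v = 0")
    case False
    have "c \<in> {1..n}" if "v = t * c" for c
    proof -
      have "0 < t" "0 < c"
        using False that by auto
      then have "c \<le> v"
        using that by simp
      then show ?thesis
        using \<open>0 < c\<close> \<open>v \<le> k\<close> k by simp
    qed
    then show ?thesis
      using False by auto
  qed simp
  moreover have "\<forall>v \<in> set ps. v \<le> k" if "sum_list ps = k" for ps
    using that member_le_sum_list by blast
  ultimately have "{ps \<in> decreasing_lists {v. \<not> t dvd v} j. sum_list ps = k} =
      {ps \<in> decreasing_lists ({0<..} - (\<lambda>k. t * k) ` {1..n}) j. sum_list ps = k}"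
    unfolding decreasing_lists_def subset_iff by blast
  then show "fps_nth (list_gf (decreasing_lists {v. \<not> t dvd v} j)
     - list_gf (decreasing_lists ({0<..} - (\<lambda>k. t * k) ` {1..n}) j)) k = 0"
    by (simp add: list_gf_def)
qed

lemma list_gf_regular_flat_of_length:
  assumes t: "0 < t"
  shows "list_gf (short_gap_lists t {v. \<not> t dvd v} j j) =
    (\<Sum>i\<le>j. (-1) ^ i * (fps_X ^ t) ^ (Suc i choose 2)
       * qpochhammer (fps_X ^ (Suc i * t)) (fps_X ^ t) (j - i)
       * list_gf (decreasing_lists {0<..} (j - i)))"
    (is "?F = (\<Sum>i\<le>j. ?term i)")
proof (rule fps_eq_if_cong_fps_X_power)
  fix n
  let ?Q = "fps_X ^ t :: rat fps"
  let ?W = "\<lambda>V. list_gf (decreasing_lists V j)"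
  \<comment> \<open>The cutoff \<open>n + j\<close> is at least \<open>n + i\<close> for every
    \<open>i \<le> j\<close>, as \<open>esym_powers_cong\<close> requires.\<close>
  let ?V = "{0<..} - (\<lambda>k. t * k) ` {1..n + j}"
  let ?err = "\<lambda>i. qpochhammer ?Q ?Q i * esym_powers ?Q (n + j) i - ?Q ^ (Suc i choose 2)"
  have F: "?F = qpochhammer ?Q ?Q j * ?W {v. \<not> t dvd v}"
    by (rule list_gf_short_gap_lists) auto
  have "qpochhammer ?Q ?Q j * ?W ?V - (\<Sum>i\<le>j. ?term i) =
      (\<Sum>i\<le>j. ?err i * ((-1) ^ i * qpochhammer (fps_X ^ (Suc i * t)) ?Q (j - i)
          * list_gf (decreasing_lists {0<..} (j - i))))"
    unfolding list_gf_avoiding_multiples[OF t] sum_distrib_left sum_subtractf[symmetric]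
  proof (rule sum.cong)
    \<comment> \<open>Splitting the Pochhammer symbol of length \<open>j\<close> at \<open>i\<close>
      supplies the factor that clears the denominator of the \<open>i\<close>-th elementary
      symmetric polynomial; the rest is the factor in \<open>?term i\<close>.\<close>
    fix i assume "i \<in> {..j}"
    then have "qpochhammer ?Q ?Q j =
        qpochhammer ?Q ?Q i * qpochhammer (fps_X ^ (Suc i * t)) ?Q (j - i)"
      using qpochhammer_add[of ?Q ?Q i "j - i"] by (simp add: mult.commute[of _ t] power_mult power_add)
    then show "qpochhammer ?Q ?Q j *
        ((-1) ^ i * esym_powers ?Q (n + j) i * list_gf (decreasing_lists {0<..} (j - i))) - ?term i =
      ?err i * ((-1) ^ i * qpochhammer (fps_X ^ (Suc i * t)) ?Q (j - i)
          * list_gf (decreasing_lists {0<..} (j - i)))"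
      by (simp only:) (simp add: algebra_simps)
  qed simp
  also have "fps_X ^ n dvd \<dots>"
    using t by (intro dvd_sum dvd_mult2 esym_powers_cong) auto
  finally have "fps_X ^ n dvd qpochhammer ?Q ?Q j * ?W ?V - (\<Sum>i\<le>j. ?term i)" .
  moreover have "fps_X ^ n dvd qpochhammer ?Q ?Q j * (?W {v. \<not> t dvd v} - ?W ?V)"
    by (intro dvd_mult dvd_trans[OF _ list_gf_regular_cong] le_imp_power_dvd) simp
  ultimately have "fps_X ^ n dvd (qpochhammer ?Q ?Q j * ?W ?V - (\<Sum>i\<le>j. ?term i))
      + qpochhammer ?Q ?Q j * (?W {v. \<not> t dvd v} - ?W ?V)"
    by (rule dvd_add)
  then show "fps_X ^ n dvd ?F - (\<Sum>i\<le>j. ?term i)"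
    unfolding F by (simp add: right_diff_distrib)
qed

section \<open>Summation over the number of parts\<close>

lemma short_gap_lists_regular:
  assumes "0 < t"
  shows "short_gap_lists t {v. \<not> t dvd v} j j =
           {ps. is_partition ps \<and> t_regular t ps \<and> t_flat t ps \<and> length ps = j}"
proof -
  \<comment> \<open>The two conditions differ only at the last part, where \<open>short_gap\<close>
    admits the value \<open>t\<close>; regularity rules it out.\<close>
  have flat: "(\<forall>k<length ps. short_gap t ps k) \<longleftrightarrow> t_flat t ps"
    if reg: "\<forall>p \<in> set ps. \<not> t dvd p" for ps
  proof (cases "ps = []")
    case False
    have "last ps \<noteq> t"
      using reg last_in_set[OF False] by auto
    then have last: "last ps \<le> t \<longleftrightarrow> last ps < t"
      by auto
    obtain m where m: "length ps = Suc m"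
      using False by (cases ps) auto
    have "ps ! m = last ps"
      using False m by (simp add: last_conv_nth)
    then show ?thesis
      using False last m unfolding t_flat_def short_gap_def
      by (metis Suc_less_eq less_Suc_eq less_irrefl_nat)
  qed (simp add: t_flat_def)
  have pos: "0 < p" if "\<not> t dvd p" for p
    using that by (cases p) auto
  show ?thesis
    using flat pos
    by (auto simp: short_gap_lists_def decreasing_lists_def is_partition_def t_regular_def subset_iff)
qed

text \<open>A partition of \<open>n\<close> has at most \<open>n\<close> parts, so the
  \<open>n\<close>-th coefficient of the partial sums is constant once \<open>N > n\<close>.\<close>

lemma regular_flat_gf_sums:
  assumes "0 < t"
  shows "(\<lambda>j. list_gf (short_gap_lists t {v. \<not> t dvd v} j j)) sums regular_flat_gf t"
  unfolding sums_def
proof (rule tendsto_fpsI)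
  fix n
  let ?S = "\<lambda>j. {ps \<in> short_gap_lists t {v. \<not> t dvd v} j j. sum_list ps = n}"
  have "fps_nth (\<Sum>j<N. list_gf (short_gap_lists t {v. \<not> t dvd v} j j)) n =
          fps_nth (regular_flat_gf t) n" if N: "n < N" for N
  proof -
    have "length ps \<le> sum_list ps" if "\<forall>p \<in> set ps. 0 < p" for ps :: "nat list"
      using that by (induction ps) auto
    then have "regular_flat_partitions t n = (\<Union>j<N. ?S j)"
      using N by (fastforce simp: short_gap_lists_regular[OF assms] regular_flat_partitions_def
          is_partition_def)
    also have "card \<dots> = (\<Sum>j<N. card (?S j))"
    proof (rule card_UN_disjoint)
      show "\<forall>j \<in> {..<N}. finite (?S j)"
        using finite_lists_of_length_and_sum[OF short_gap_lists_length] by blast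
    qed (auto simp: short_gap_lists_regular[OF assms])
    finally show ?thesis
      by (simp add: regular_flat_gf_def list_gf_def fps_sum_nth)
  qed
  then show "\<forall>\<^sub>F N in sequentially. fps_nth (\<Sum>j<N. list_gf (short_gap_lists t {v. \<not> t dvd v} j j)) n =
          fps_nth (regular_flat_gf t) n"
    by (auto simp: eventually_sequentially intro!: exI[of _ "Suc n"])
qed

theorem theorem9:
  fixes t :: nat
  assumes "t \<ge> 2"
  shows "(\<lambda>j. \<Sum>i=0..j.
            (-1) ^ i * fps_X ^ (((i + 1) choose 2) * t + (j - i))
              * qpochhammer (fps_X ^ ((i + 1) * t)) (fps_X ^ t) (j - i)
            / qpochhammer fps_X fps_X (j - i))
         sums regular_flat_gf t"
proof -
  have t: "0 < t"
    using assms by simp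
  have nonzero: "qpochhammer fps_X fps_X m \<noteq> (0 :: rat fps)" for m
    using list_gf_positive_parts[of m] by auto
  have "(-1) ^ i * fps_X ^ (((i + 1) choose 2) * t + (j - i))
              * qpochhammer (fps_X ^ ((i + 1) * t)) (fps_X ^ t) (j - i)
            / qpochhammer fps_X fps_X (j - i) =
      (-1) ^ i * (fps_X ^ t) ^ (Suc i choose 2)
       * qpochhammer (fps_X ^ (Suc i * t)) (fps_X ^ t) (j - i)
       * list_gf (decreasing_lists {0<..} (j - i))" (is "?n / ?d = ?r") for i j
  proof -
    \<comment> \<open>The quotient of power series is exact: \<open>fps_X ^ (j - i)\<close> in the
      numerator is the denominator times the enumerator of all partitions with \<open>j - i\<close>
      parts.\<close>
    have "?n = ?d * ?r"
      unfolding power_add mult.commute[of "(i + 1) choose 2" t] power_mult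
        list_gf_positive_parts[of "j - i", symmetric]
      by (simp add: mult_ac)
    then show ?thesis
      by (simp only: nonzero_mult_div_cancel_left[OF nonzero])
  qed
  then show ?thesis
    using regular_flat_gf_sums[OF t]
    by (simp only: list_gf_regular_flat_of_length[OF t] atLeast0AtMost)
qed

end
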